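(* Let $r$ be a positive integer and let $P$ be an $r$-differential poset. For each $n\ge 0$ let $p_n$ be the number of elements of $P$ of rank $n$. Then $p_1<p_2<p_3<\cdots$, i.e. $p_n<p_{n+1}$ for every $n\ge 1$.
   Context: For a positive integer $r$, an $r$-differential poset is a graded poset $P$ with a minimum element $\hat 0$ (of rank $0$), having all intervals and all rank cardinalities finite, satisfying: (D1) if an element of $P$ covers exactly $m$ elements, then it is covered by exactly $m+r$ elements; (D2) if two distinct elements of $P$ have exactly $m$ elements that they both cover, then there are exactly $m$ elements that cover them both. Here graded means that $P$ has a rank function $\mathrm{rank}:P\to\mathbb{Z}_{\ge 0}$ with $\mathrm{rank}(\hat 0)=0$ and $\mathrm{rank}(y)=\mathrm{rank}(x)+1$ whenever $y$ covers $x$. The set of elements of rank $n$ is denoted $P_n$, and $p_n:=|P_n|$. *)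

theory Defs
  imports Main
begin

text \<open>
  Posets are given by a carrier set \<open>P\<close> and a relation \<open>le\<close> with \<^term>\<open>partial_order_on P le\<close>
  (so \<open>le \<subseteq> P \<times> P\<close>).
\<close>

definition covers :: "('a \<times> 'a) set \<Rightarrow> 'a \<Rightarrow> 'a \<Rightarrow> bool" where
  "covers le y x \<longleftrightarrow>
     (x, y) \<in> le \<and> x \<noteq> y \<and>
     \<not> (\<exists>z. (x, z) \<in> le \<and> x \<noteq> z \<and> (z, y) \<in> le \<and> z \<noteq> y)"

definition rank_level :: "'a set \<Rightarrow> ('a \<Rightarrow> nat) \<Rightarrow> nat \<Rightarrow> 'a set" where
  "rank_level P rk n = {x \<in> P. rk x = n}"

locale graded_poset =
  fixes P :: "'a set"
    and le :: "('a \<times> 'a) set"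
    and bot :: 'a
    and rk :: "'a \<Rightarrow> nat"
  assumes partial_order: "partial_order_on P le"
    and bot_in: "bot \<in> P"
    and bot_le: "x \<in> P \<Longrightarrow> (bot, x) \<in> le"
    and rank_bot: "rk bot = 0"
    and rank_covers: "covers le y x \<Longrightarrow> rk y = Suc (rk x)"

text \<open>
  All sets whose cardinality is taken in \<open>D1\<close> and \<open>D2\<close> are finite, since each lies in a single
  rank level; so \<^const>\<open>card\<close> is the true number of elements.
\<close>

locale differential_poset = graded_poset P le bot rk
  for r :: nat
    and P :: "'a set"
    and le :: "('a \<times> 'a) set"
    and bot :: 'a
    and rk :: "'a \<Rightarrow> nat" +
  assumes r_pos: "r > 0"
    and finite_interval:
      "\<lbrakk>x \<in> P; y \<in> P\<rbrakk> \<Longrightarrow> finite {z \<in> P. (x, z) \<in> le \<and> (z, y) \<in> le}"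
    and finite_rank_level: "finite (rank_level P rk n)"
    and D1: "\<lbrakk>x \<in> P; card {z \<in> P. covers le x z} = m\<rbrakk>
      \<Longrightarrow> card {y \<in> P. covers le y x} = m + r"
    and D2: "\<lbrakk>x \<in> P; y \<in> P; x \<noteq> y; card {z \<in> P. covers le x z \<and> covers le y z} = m\<rbrakk>
      \<Longrightarrow> card {z \<in> P. covers le z x \<and> covers le z y} = m"

end

theory Submission
  imports Defs
begin

text \<open>
  On integer-valued functions on \<open>P\<close>, let \<open>U\<close> (\<open>up\<close>) and \<open>D\<close> (\<open>down\<close>) be the transposed operators
  that sum over lower and upper covers, so that on point masses \<open>U\<close> moves a point to the sum
  of the elements covering it.  The two axioms of a differential poset amount to \<open>D U = U D + r\<close>
  (lemma \<open>down_up\<close>).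

  Suppose rank \<open>N = n + 1\<close>, where \<open>n \<ge> 1\<close>, is no larger than rank \<open>n\<close>.  Since
  \<open>D U = D\<^sup>T D + r\<close> is positive definite, \<open>U\<close> is injective, and by dimension \<open>D\<close> is
  injective on rank \<open>N\<close>; hence so is \<open>U D\<close>.  The commutation relation gives the factorisation
  \<open>U\<^sup>N D\<^sup>N = U D (U D - r) (U D - 2 r) \<dots> (U D - (N - 1) r)\<close>,
  so \<open>U\<^sup>N D\<^sup>N f\<close> is \<open>U D\<close> of an \<^emph>\<open>integral\<close> function for each integral \<open>f\<close>
  of rank \<open>N\<close> (lemma \<open>up_down_divides_funpow\<close>).

  Let \<open>w\<close> be \<open>U\<^sup>N\<close> applied to the point mass at the minimum; its value at \<open>x\<close> of rank \<open>N\<close>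
  counts the saturated chains from the minimum to \<open>x\<close>, and \<open>U D w = r N w\<close>.
  Every rank contains some \<open>y\<close> reached by exactly one such chain (lemma \<open>exists_single_chain_element\<close>).
  Taking for \<open>f\<close> the point mass at \<open>y\<close> gives \<open>U\<^sup>N D\<^sup>N f = w\<close>, so \<open>w = U D q\<close> for an
  integral \<open>q\<close>, while also \<open>U D w = r N w = U D (r N q)\<close>.  By injectivity \<open>w = r N q\<close>, and
  evaluating at \<open>y\<close> shows that \<open>r N\<close> divides \<open>1\<close>.  This is absurd because \<open>N \<ge> 2\<close>.
\<close>

section \<open>Underdetermined homogeneous systems over an integral domain\<close>

text \<open>
  Fraction-free Gaussian elimination on the equations: a pivot unknown \<open>p\<close> of the equation \<open>b\<close>
  is eliminated from the others by cross-multiplication, and a solution \<open>c\<close> of the smaller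
  system, scaled by the pivot, leaves \<open>p\<close> determined by \<open>b\<close> without any division.
\<close>

lemma homogeneous_system_nontrivial_solution:
  fixes M :: "'b \<Rightarrow> 'c \<Rightarrow> 'k::idom"
  assumes "finite B" and "finite A" and "card B < card A"
  shows "\<exists>c. (\<exists>a\<in>A. c a \<noteq> 0) \<and> (\<forall>b\<in>B. (\<Sum>a\<in>A. M b a * c a) = 0)"
  using assms
proof (induction B arbitrary: A M rule: finite_induct)
  case empty
  then obtain a where "a \<in> A" by fastforce
  then show ?case by (intro exI[of _ "\<lambda>_. 1"]) auto
next
  case (insert b B)
  show ?case
  proof (cases "\<forall>a\<in>A. M b a = 0")
    case True
    have "card B < card A" using insert by simp
    from insert.IH[OF insert.prems(1) this, of M] True show ?thesis by auto
  next
    case False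
    then obtain p where p: "p \<in> A" "M b p \<noteq> 0" by blast
    let ?A = "A - {p}"
    have "card B < card ?A" "finite ?A" using insert p by auto
    from insert.IH[OF this(2,1), of "\<lambda>b' a. M b p * M b' a - M b' p * M b a"]
    obtain c where c: "\<exists>a\<in>?A. c a \<noteq> 0"
      "\<And>b'. b' \<in> B \<Longrightarrow> (\<Sum>a\<in>?A. (M b p * M b' a - M b' p * M b a) * c a) = 0"
      by blast
    define d where "d a = (if a = p then - (\<Sum>a\<in>?A. M b a * c a) else M b p * c a)" for a
    have split: "(\<Sum>a\<in>A. M b' a * d a)
        = (\<Sum>a\<in>?A. (M b p * M b' a - M b' p * M b a) * c a)" for b'
    proof -
      have "(\<Sum>a\<in>A. M b' a * d a) = M b' p * d p + (\<Sum>a\<in>?A. M b' a * d a)"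
        using insert.prems(1) p(1) by (rule sum.remove)
      also have "(\<Sum>a\<in>?A. M b' a * d a) = (\<Sum>a\<in>?A. M b p * M b' a * c a)"
        by (rule sum.cong) (auto simp: d_def)
      also have "M b' p * d p = - (\<Sum>a\<in>?A. M b' p * M b a * c a)"
        by (simp add: d_def sum_distrib_left mult.assoc)
      finally show ?thesis by (simp add: left_diff_distrib sum_subtractf)
    qed
    have "(\<Sum>a\<in>A. M b' a * d a) = 0" if "b' \<in> insert b B" for b'
      using that c(2) unfolding split by (auto simp: mult.commute)
    moreover have "\<exists>a\<in>A. d a \<noteq> 0" using c(1) p by (auto simp: d_def)
    ultimately show ?thesis by blast
  qed
qed

section \<open>Up and down operators on a graded poset\<close>

context graded_poset
begin

definition upper_covers :: "'a \<Rightarrow> 'a set" where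
  "upper_covers x = {y \<in> P. covers le y x}"

definition lower_covers :: "'a \<Rightarrow> 'a set" where
  "lower_covers x = {z \<in> P. covers le x z}"

definition up :: "('a \<Rightarrow> int) \<Rightarrow> 'a \<Rightarrow> int" where
  "up f y = (\<Sum>x\<in>lower_covers y. f x)"

definition down :: "('a \<Rightarrow> int) \<Rightarrow> 'a \<Rightarrow> int" where
  "down f x = (\<Sum>y\<in>upper_covers x. f y)"

definition supported_on :: "'a set \<Rightarrow> ('a \<Rightarrow> int) \<Rightarrow> bool" where
  "supported_on A f \<longleftrightarrow> (\<forall>x. f x \<noteq> 0 \<longrightarrow> x \<in> A)"

definition point :: "'a \<Rightarrow> 'a \<Rightarrow> int" where
  "point x = (\<lambda>z. if z = x then 1 else 0)"

abbreviation level :: "nat \<Rightarrow> 'a set" where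
  "level n \<equiv> rank_level P rk n"

lemma covers_in: "covers le y x \<Longrightarrow> x \<in> P \<and> y \<in> P"
  using partial_order
  by (auto simp: covers_def partial_order_on_def preorder_on_def refl_on_def)

lemma upper_covers_iff: "y \<in> upper_covers x \<longleftrightarrow> covers le y x"
  and lower_covers_iff: "x \<in> lower_covers y \<longleftrightarrow> covers le y x"
  using covers_in by (auto simp: upper_covers_def lower_covers_def)

lemma upper_covers_level: "x \<in> level n \<Longrightarrow> upper_covers x \<subseteq> level (Suc n)"
  using covers_in rank_covers by (auto simp: upper_covers_iff rank_level_def)

lemma lower_covers_level: "x \<in> level (Suc n) \<Longrightarrow> lower_covers x \<subseteq> level n"
  using covers_in rank_covers by (force simp: lower_covers_iff rank_level_def)

lemma lower_covers_level_0: "x \<in> level 0 \<Longrightarrow> lower_covers x = {}"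
  using rank_covers by (force simp: lower_covers_iff rank_level_def)

lemma covers_outside:
  "x \<notin> P \<Longrightarrow> upper_covers x = {}" "x \<notin> P \<Longrightarrow> lower_covers x = {}"
  using covers_in by (auto simp: upper_covers_iff lower_covers_iff)

lemma supported_on_level: "supported_on (level n) f \<Longrightarrow> supported_on P f"
  by (auto simp: supported_on_def rank_level_def)

lemma supported_on_linear:
  "supported_on A f \<Longrightarrow> supported_on A g \<Longrightarrow> supported_on A (\<lambda>x. a * f x + b * g x)"
  unfolding supported_on_def by (metis add.right_neutral mult_zero_right)

lemma supported_on_P_up: "supported_on P (up f)"
  and supported_on_P_down: "supported_on P (down f)"
  using covers_outside by (force simp: supported_on_def up_def down_def)+

lemma supported_on_up: "supported_on (level n) f \<Longrightarrow> supported_on (level (Suc n)) (up f)"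
  unfolding supported_on_def up_def
proof (intro allI impI)
  fix y assume f: "\<forall>x. f x \<noteq> 0 \<longrightarrow> x \<in> level n" and "(\<Sum>x\<in>lower_covers y. f x) \<noteq> 0"
  then obtain x where "x \<in> lower_covers y" "f x \<noteq> 0"
    by (meson sum.not_neutral_contains_not_neutral)
  then show "y \<in> level (Suc n)"
    using f upper_covers_level upper_covers_iff lower_covers_iff by blast
qed

lemma supported_on_down: "supported_on (level (Suc n)) f \<Longrightarrow> supported_on (level n) (down f)"
  unfolding supported_on_def down_def
proof (intro allI impI)
  fix x assume f: "\<forall>x. f x \<noteq> 0 \<longrightarrow> x \<in> level (Suc n)" and "(\<Sum>y\<in>upper_covers x. f y) \<noteq> 0"
  then obtain y where "y \<in> upper_covers x" "f y \<noteq> 0"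
    by (meson sum.not_neutral_contains_not_neutral)
  then show "x \<in> level n"
    using f lower_covers_level upper_covers_iff lower_covers_iff by blast
qed

lemma down_level_0: "supported_on (level 0) f \<Longrightarrow> down f = (\<lambda>x. 0)"
  using rank_covers
  by (force simp: supported_on_def down_def rank_level_def upper_covers_iff intro!: sum.neutral)

lemma up_linear: "up (\<lambda>x. a * f x + b * g x) = (\<lambda>x. a * up f x + b * up g x)"
  and down_linear: "down (\<lambda>x. a * f x + b * g x) = (\<lambda>x. a * down f x + b * down g x)"
  by (simp_all add: up_def down_def fun_eq_iff sum.distrib sum_distrib_left)

lemma funpow_down_linear:
  "(down ^^ k) (\<lambda>x. a * f x + b * g x) = (\<lambda>x. a * (down ^^ k) f x + b * (down ^^ k) g x)"
  by (induction k) (simp_all add: down_linear)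

lemma up_down_linear:
  "up (down (\<lambda>x. a * f x + b * g x)) = (\<lambda>x. a * up (down f) x + b * up (down g) x)"
  by (simp only: up_linear down_linear)

end

section \<open>The commutation relation in a differential poset\<close>

context differential_poset
begin

lemma finite_upper_covers: "finite (upper_covers x)"
  and finite_lower_covers: "finite (lower_covers x)"
proof -
  have "upper_covers x \<subseteq> level (Suc (rk x))"
    using covers_in rank_covers by (auto simp: upper_covers_iff rank_level_def)
  moreover have "lower_covers x \<subseteq> level (rk x - 1)"
  proof
    fix z assume "z \<in> lower_covers x"
    then have "covers le x z" by (simp add: lower_covers_iff)
    then show "z \<in> level (rk x - 1)"
      using covers_in rank_covers by (simp add: rank_level_def)
  qed
  ultimately show "finite (upper_covers x)" "finite (lower_covers x)"
    using finite_rank_level by (blast intro: finite_subset)+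
qed

lemma card_upper_covers: "x \<in> P \<Longrightarrow> card (upper_covers x) = card (lower_covers x) + r"
  using D1 by (auto simp: upper_covers_def lower_covers_def)

lemma card_common_covers:
  assumes "x \<in> P" "y \<in> P" "x \<noteq> y"
  shows "card (upper_covers x \<inter> upper_covers y) = card (lower_covers x \<inter> lower_covers y)"
proof -
  have "upper_covers x \<inter> upper_covers y = {z \<in> P. covers le z x \<and> covers le z y}"
    "lower_covers x \<inter> lower_covers y = {z \<in> P. covers le x z \<and> covers le y z}"
    by (auto simp: upper_covers_def lower_covers_def)
  then show ?thesis using D2[OF assms refl] by simp
qed

text \<open>
  The interval from the minimum to \<open>x\<close> is finite, so it has a maximal element below \<open>x\<close>,
  and \<open>x\<close> covers it.
\<close>

lemma lower_covers_nonempty: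
  assumes "x \<in> P" "x \<noteq> bot"
  shows "lower_covers x \<noteq> {}"
proof -
  have tr: "trans le" and an: "antisym le"
    using partial_order by (auto simp: partial_order_on_def preorder_on_def)
  let ?S = "{z \<in> P. (bot, z) \<in> le \<and> (z, x) \<in> le} - {x}"
  have fin: "finite ?S" using finite_interval[OF bot_in assms(1)] by simp
  have "bot \<in> ?S" using assms bot_in bot_le by auto
  have wf: "wf ({(b, a). (a, b) \<in> le \<and> a \<noteq> b} \<inter> ?S \<times> ?S)" (is "wf ?R")
  proof (rule finite_acyclic_wf)
    show "finite ?R" using fin by (simp add: finite_subset)
    have "trans ?R" using tr an unfolding trans_def antisym_def by blast
    then show "acyclic ?R" by (auto simp: acyclic_def)
  qed
  obtain m where m: "m \<in> ?S" "\<And>z. (z, m) \<in> ?R \<Longrightarrow> z \<notin> ?S"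
    by (rule wfE_min[OF wf \<open>bot \<in> ?S\<close>]) blast
  have "covers le x m"
    unfolding covers_def
  proof (intro conjI notI)
    show "(m, x) \<in> le" "m = x \<Longrightarrow> False" using m by auto
    assume "\<exists>z. (m, z) \<in> le \<and> m \<noteq> z \<and> (z, x) \<in> le \<and> z \<noteq> x"
    then obtain z where z: "(m, z) \<in> le" "m \<noteq> z" "(z, x) \<in> le" "z \<noteq> x" by blast
    then have "z \<in> P" "(bot, z) \<in> le" 
      using partial_order m(1) transD[OF tr]
      by (auto simp: partial_order_on_def preorder_on_def refl_on_def)
    then show False using z m by auto
  qed
  then show ?thesis using lower_covers_iff by auto
qed

lemma level_0: "level 0 = {bot}"
  using lower_covers_nonempty lower_covers_level_0 bot_in rank_bot
  by (auto simp: rank_level_def)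

text \<open>
  Both sides are combinations of values \<open>f z\<close>.  For \<open>z \<noteq> x\<close> the coefficients are the numbers
  of common upper and of common lower covers of \<open>x\<close> and \<open>z\<close>, which agree; for \<open>z = x\<close> they are
  the numbers of upper and of lower covers of \<open>x\<close>, which differ by \<open>r\<close>.
\<close>

lemma down_up:
  assumes "supported_on P f"
  shows "down (up f) = (\<lambda>x. up (down f) x + int r * f x)"
proof
  fix x
  show "down (up f) x = up (down f) x + int r * f x"
  proof (cases "x \<in> P")
    case False
    then show ?thesis using assms covers_outside by (auto simp: up_def down_def supported_on_def)
  next
    case True
    \<comment> \<open>\<open>T\<close> is a finite index set containing every \<open>z\<close> that occurs on either side.\<close>
    let ?V = "\<Union>y\<in>upper_covers x. lower_covers y"
    let ?W = "\<Union>z\<in>lower_covers x. upper_covers z"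
    let ?T = "insert x (?V \<union> ?W)"
    have fin: "finite ?T" using finite_upper_covers finite_lower_covers by auto
    have TP: "?T \<subseteq> P" using True covers_in by (auto simp: upper_covers_iff lower_covers_iff)
    have "down (up f) x
        = (\<Sum>y\<in>upper_covers x. \<Sum>z | z \<in> ?T \<and> covers le y z. f z)"
      unfolding up_def down_def
      by (intro sum.cong refl) (auto simp: upper_covers_iff lower_covers_iff)
    also have "\<dots> = (\<Sum>z\<in>?T. \<Sum>y | y \<in> upper_covers x \<and> covers le y z. f z)"
      by (rule sum.swap_restrict[OF finite_upper_covers fin])
    also have "\<dots> = (\<Sum>z\<in>?T. int (card (upper_covers x \<inter> upper_covers z)) * f z)"
      by (auto intro!: sum.cong arg_cong[where f = card] simp: upper_covers_iff)
    also have "\<dots> = (\<Sum>z\<in>?T. int (card (lower_covers x \<inter> lower_covers z)) * f z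
        + (if z = x then int r * f x else 0))"
      using TP True card_common_covers card_upper_covers[OF True]
      by (intro sum.cong) (auto simp: algebra_simps subset_iff)
    also have "\<dots> = (\<Sum>z\<in>?T. int (card (lower_covers x \<inter> lower_covers z)) * f z) + int r * f x"
      using fin by (simp add: sum.distrib del: sum.insert)
    also have "(\<Sum>z\<in>?T. int (card (lower_covers x \<inter> lower_covers z)) * f z)
        = (\<Sum>z\<in>?T. \<Sum>y | y \<in> lower_covers x \<and> covers le z y. f z)"
      by (auto intro!: sum.cong arg_cong[where f = card] simp: lower_covers_iff)
    also have "\<dots> = (\<Sum>y\<in>lower_covers x. \<Sum>z | z \<in> ?T \<and> covers le z y. f z)"
      by (rule sum.swap_restrict[OF finite_lower_covers fin, symmetric])
    also have "\<dots> = up (down f) x"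
      unfolding up_def down_def
      by (intro sum.cong refl) (auto simp: upper_covers_iff lower_covers_iff)
    finally show ?thesis .
  qed
qed

lemma funpow_down_up:
  assumes "supported_on P f"
  shows "(down ^^ Suc k) (up f)
    = (\<lambda>x. up ((down ^^ Suc k) f) x + int (r * Suc k) * (down ^^ k) f x)"
proof (induction k)
  case 0
  then show ?case using down_up[OF assms] by simp
next
  case (Suc k)
  let ?g = "(down ^^ Suc k) f"
  have g: "supported_on P ?g" using supported_on_P_down by simp
  have "(down ^^ Suc (Suc k)) (up f)
      = down (\<lambda>x. 1 * up ?g x + int (r * Suc k) * (down ^^ k) f x)"
    using Suc by simp
  also have "\<dots> = (\<lambda>x. down (up ?g) x + int (r * Suc k) * ?g x)"
    unfolding down_linear by simp
  also have "\<dots> = (\<lambda>x. up (down ?g) x + int (r * Suc (Suc k)) * ?g x)"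
    unfolding down_up[OF g] by (simp add: algebra_simps del: funpow.simps)
  finally show ?case by simp
qed

text \<open>
  Moving one factor at a time through \<open>funpow_down_up\<close> gives
  \<open>U\<^bsup>k+2\<^esup> D\<^bsup>k+2\<^esup> = U\<^bsup>k+1\<^esup> D\<^bsup>k+1\<^esup> (U D - r (k + 1))\<close>, so \<open>U\<^bsup>k+1\<^esup> D\<^bsup>k+1\<^esup>\<close> is \<open>U D\<close> times an integer
  polynomial in \<open>U D\<close>.  The integrality of \<open>q\<close> is the point of the lemma: the final
  contradiction is a divisibility statement.
\<close>

lemma up_down_divides_funpow:
  assumes "supported_on (level N) f"
  shows "\<exists>q. supported_on (level N) q \<and> up (down q) = (up ^^ Suc k) ((down ^^ Suc k) f)"
  using assms
proof (induction k arbitrary: f)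
  case 0
  then show ?case by auto
next
  case (Suc k)
  let ?c = "int (r * Suc k)"
  let ?f = "\<lambda>x. 1 * up (down f) x + (- ?c) * f x"
  have "supported_on (level N) (up (down f))"
  proof (cases N)
    case 0
    then show ?thesis using Suc.prems down_level_0 by (simp add: supported_on_def up_def)
  next
    case (Suc m)
    then show ?thesis using Suc.prems supported_on_down supported_on_up by simp
  qed
  then have "supported_on (level N) ?f"
    using Suc.prems by (rule supported_on_linear)
  then obtain q where q: "supported_on (level N) q"
    "up (down q) = (up ^^ Suc k) ((down ^^ Suc k) ?f)"
    using Suc.IH by blast
  have "(down ^^ Suc k) ?f = up ((down ^^ Suc (Suc k)) f)"
    unfolding funpow_down_linear funpow_down_up[OF supported_on_P_down]
    by (simp add: funpow_swap1 algebra_simps)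
  then have "up (down q) = (up ^^ Suc (Suc k)) ((down ^^ Suc (Suc k)) f)"
    using q(2) by (simp add: funpow_swap1)
  then show ?case using q(1) by blast
qed

section \<open>Injectivity\<close>

lemma up_adjoint_down:
  "(\<Sum>y\<in>level (Suc n). up f y * g y) = (\<Sum>x\<in>level n. f x * down g x)"
proof -
  have "(\<Sum>y\<in>level (Suc n). up f y * g y)
      = (\<Sum>y\<in>level (Suc n). \<Sum>x | x \<in> level n \<and> covers le y x. f x * g y)"
    unfolding up_def sum_distrib_right using lower_covers_level
    by (intro sum.cong refl) (auto simp: lower_covers_iff)
  also have "\<dots> = (\<Sum>x\<in>level n. \<Sum>y | y \<in> level (Suc n) \<and> covers le y x. f x * g y)"
    by (rule sum.swap_restrict[OF finite_rank_level finite_rank_level])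
  also have "\<dots> = (\<Sum>x\<in>level n. f x * down g x)"
    unfolding down_def sum_distrib_left using upper_covers_level
    by (intro sum.cong refl) (auto simp: upper_covers_iff)
  finally show ?thesis .
qed

text \<open>
  Pairing \<open>D U f = 0\<close> with \<open>f\<close> gives \<open>0 = \<langle>D f, D f\<rangle> + r \<langle>f, f\<rangle>\<close> by the commutation
  relation and adjointness.
\<close>

lemma down_up_injective:
  assumes f: "supported_on (level n) f" and zero: "down (up f) = (\<lambda>x. 0)"
  shows "f = (\<lambda>x. 0)"
proof -
  have nonneg: "0 \<le> (\<Sum>x\<in>level n. f x * up (down f) x)"
  proof (cases n)
    case 0
    then show ?thesis using lower_covers_level_0 by (simp add: up_def)
  next
    case (Suc m)
    then have "(\<Sum>x\<in>level n. f x * up (down f) x) = (\<Sum>x\<in>level m. down f x * down f x)"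
      using up_adjoint_down[of "down f" f m] by (simp add: mult.commute)
    then show ?thesis by (simp add: sum_nonneg)
  qed
  have "0 = (\<Sum>x\<in>level n. f x * down (up f) x)" using zero by simp
  also have "\<dots> = (\<Sum>x\<in>level n. f x * up (down f) x) + int r * (\<Sum>x\<in>level n. f x * f x)"
    unfolding down_up[OF supported_on_level[OF f]]
    by (simp add: algebra_simps sum.distrib sum_distrib_left)
  finally have "int r * (\<Sum>x\<in>level n. f x * f x) \<le> 0" using nonneg by linarith
  then have "(\<Sum>x\<in>level n. f x * f x) \<le> 0" using r_pos by (simp add: mult_le_0_iff)
  then have "(\<Sum>x\<in>level n. f x * f x) = 0"
    by (intro antisym sum_nonneg) auto
  then have "\<forall>x\<in>level n. f x = 0"
    using sum_nonneg_eq_0_iff[OF finite_rank_level, of n "\<lambda>x. f x * f x"] by auto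
  then show ?thesis using f by (auto simp: supported_on_def)
qed

lemma up_injective:
  assumes "supported_on (level n) f" and "up f = (\<lambda>x. 0)"
  shows "f = (\<lambda>x. 0)"
  by (rule down_up_injective[OF assms(1)]) (simp add: assms(2) down_def fun_eq_iff)

text \<open>
  An injective \<open>U\<close> from rank \<open>n\<close> into a rank that is not larger is onto up to scalars: some
  nonzero multiple of \<open>g\<close> is \<open>U f\<close>.  Then \<open>D g = 0\<close> yields \<open>D U f = 0\<close>, whence \<open>f = 0\<close>
  and \<open>g = 0\<close>.
\<close>

lemma down_injective_if_no_growth:
  assumes card: "card (level (Suc n)) \<le> card (level n)"
    and g: "supported_on (level (Suc n)) g" and zero: "down g = (\<lambda>x. 0)"
  shows "g = (\<lambda>x. 0)"
proof -
  \<comment> \<open>The unknown \<open>None\<close> is the coefficient of \<open>g\<close>; the unknowns \<open>Some x\<close> are the values of \<open>f\<close>.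
    There is one equation for each element of rank \<open>n + 1\<close>.\<close>
  let ?A = "insert None (Some ` level n)"
  let ?M = "\<lambda>y a. case a of None \<Rightarrow> g y | Some x \<Rightarrow> if covers le y x then 1 else 0"
  have fin: "finite (level n)" using finite_rank_level .
  have "card ?A = Suc (card (level n))"
    using fin by (simp add: card_image)
  then have "card (level (Suc n)) < card ?A" using card by simp
  then obtain c where c: "\<exists>a\<in>?A. c a \<noteq> 0"
    and sol: "\<And>y. y \<in> level (Suc n) \<Longrightarrow> (\<Sum>a\<in>?A. ?M y a * c a) = 0"
    using homogeneous_system_nontrivial_solution[OF finite_rank_level, of ?A "Suc n" ?M] fin
    by auto
  define f where "f x = (if x \<in> level n then c (Some x) else 0)" for x
  have f: "supported_on (level n) f" by (simp add: supported_on_def f_def)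
  have rel: "up f y = - c None * g y" for y
  proof (cases "y \<in> level (Suc n)")
    case True
    have "up f y = (\<Sum>x | x \<in> level n \<and> covers le y x. f x)"
      unfolding up_def using lower_covers_level[OF True]
      by (intro sum.cong refl) (auto simp: lower_covers_iff)
    also have "\<dots> = (\<Sum>x\<in>level n. if covers le y x then f x else 0)"
      by (simp only: sum.inter_filter[OF fin])
    also have "\<dots> = (\<Sum>x\<in>level n. ?M y (Some x) * c (Some x))"
      by (rule sum.cong) (auto simp: f_def)
    finally show ?thesis
      using sol[OF True] fin by (simp add: sum.reindex mult.commute)
  next
    case False
    then have "up f y = 0" "g y = 0"
      using supported_on_up[OF f] g by (auto simp: supported_on_def)
    then show ?thesis by simp
  qed
  then have "up f = (\<lambda>y. (- c None) * g y + 0 * g y)" by auto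
  then have "down (up f) = (\<lambda>x. 0)" by (simp only: down_linear zero) simp
  then have f0: "f = (\<lambda>x. 0)" using down_up_injective f by blast
  then have "\<forall>x\<in>level n. c (Some x) = 0" by (metis f_def)
  then have "c None \<noteq> 0" using c by auto
  moreover have "c None * g y = 0" for y
    using rel[of y] f0 by (simp add: up_def)
  ultimately show ?thesis by auto
qed

section \<open>An element with a single saturated chain in every rank\<close>

text \<open>
  A count: \<open>x\<close> has \<open>r + 1\<close> upper covers.  One that covers a second element \<open>x'\<close> forces \<open>x\<close>
  and \<open>x'\<close> to share a lower cover, which can only be \<open>z\<close>; so \<open>x'\<close> is one of the at most \<open>r\<close>
  other upper covers of \<open>z\<close>, and since \<open>x\<close> and \<open>x'\<close> share only \<open>z\<close> below, each \<open>x'\<close> accounts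
  for at most one upper cover of \<open>x\<close>.  At least one upper cover remains.
\<close>

lemma exists_single_covering_extension:
  assumes x: "lower_covers x = {z}" and z: "card (upper_covers z) \<le> Suc r"
  shows "\<exists>y. lower_covers y = {x}"
proof (rule ccontr)
  assume no: "\<nexists>y. lower_covers y = {x}"
  have xz: "covers le x z" using x lower_covers_iff by auto
  then have xP: "x \<in> P" using covers_in by blast
  let ?S = "upper_covers z - {x}"
  have sub: "upper_covers x \<subseteq> (\<Union>x'\<in>?S. upper_covers x \<inter> upper_covers x')"
  proof
    fix y assume y: "y \<in> upper_covers x"
    then have "x \<in> lower_covers y" by (simp add: upper_covers_iff lower_covers_iff)
    then obtain x' where x': "x' \<in> lower_covers y" "x' \<noteq> x" using no by blast
    then have yx': "y \<in> upper_covers x \<inter> upper_covers x'" and "x' \<in> P"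
      using y covers_in by (auto simp: upper_covers_iff lower_covers_iff)
    then have "card (upper_covers x \<inter> upper_covers x') \<noteq> 0"
      using finite_upper_covers by (metis card_0_eq empty_iff finite_Int)
    then have "lower_covers x \<inter> lower_covers x' \<noteq> {}"
      using card_common_covers[OF xP \<open>x' \<in> P\<close>] x'(2) by auto
    then have "z \<in> lower_covers x'" using x by (cases "z \<in> lower_covers x'") auto
    then have "x' \<in> ?S" using x' by (simp add: upper_covers_iff lower_covers_iff)
    then show "y \<in> (\<Union>x'\<in>?S. upper_covers x \<inter> upper_covers x')" using yx' by blast
  qed
  have "card (upper_covers x \<inter> upper_covers x') \<le> 1" if "x' \<in> ?S" for x'
  proof -
    have "x' \<in> P" "x \<noteq> x'" using that covers_in by (auto simp: upper_covers_iff)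
    then have "card (upper_covers x \<inter> upper_covers x') = card ({z} \<inter> lower_covers x')"
      using card_common_covers[OF xP] x by simp
    also have "\<dots> \<le> card {z}" by (rule card_mono) auto
    finally show ?thesis by simp
  qed
  then have "(\<Sum>x'\<in>?S. card (upper_covers x \<inter> upper_covers x')) \<le> of_nat (card ?S) * 1"
    by (rule sum_bounded_above)
  moreover have "card (upper_covers x)
      \<le> (\<Sum>x'\<in>?S. card (upper_covers x \<inter> upper_covers x'))"
    using sub finite_upper_covers
    by (intro order_trans[OF card_mono card_UN_le]) auto
  moreover have "card ?S \<le> r"
    using z xz finite_upper_covers by (simp add: upper_covers_iff)
  ultimately show False using card_upper_covers[OF xP] x by simp
qed

lemma down_point: "lower_covers y = {z} \<Longrightarrow> down (point y) = point z"
proof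
  fix x assume "lower_covers y = {z}"
  then have "y \<in> upper_covers x \<longleftrightarrow> x = z"
    using lower_covers_iff[of x y] by (simp add: upper_covers_iff)
  then show "down (point y) x = point z x"
    using finite_upper_covers by (simp add: down_def point_def)
qed

text \<open>
  Iterating the extension from an atom; the bound on the upper covers of \<open>z\<close> is what the next
  extension needs.  It holds with slack at the minimum, which has \<open>r\<close> upper covers, and with
  equality later, when \<open>z\<close> covers a single element.
\<close>

lemma exists_single_chain_element:
  "\<exists>y z. y \<in> level (Suc n) \<and> lower_covers y = {z} \<and> card (upper_covers z) \<le> Suc r \<and>
    (down ^^ Suc n) (point y) = point bot \<and> (up ^^ Suc n) (point bot) y = 1"
proof (induction n)
  case 0
  have bot: "bot \<in> level 0" using level_0 by simp
  then have card: "card (upper_covers bot) = r"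
    using card_upper_covers[OF bot_in] lower_covers_level_0 by simp
  then obtain y where y: "y \<in> upper_covers bot" using r_pos by fastforce
  then have "y \<in> level (Suc 0)" using upper_covers_level bot by blast
  moreover have lower: "lower_covers y = {bot}"
    using lower_covers_level[OF calculation] level_0 y
    by (auto simp: upper_covers_iff lower_covers_iff)
  moreover have "up (point bot) y = 1"
    using lower by (simp add: up_def point_def)
  ultimately show ?case using card down_point[OF lower] by auto
next
  case (Suc n)
  then obtain y z where y: "y \<in> level (Suc n)" "lower_covers y = {z}"
    "card (upper_covers z) \<le> Suc r" "(down ^^ Suc n) (point y) = point bot"
    "(up ^^ Suc n) (point bot) y = 1" by blast
  obtain y' where y': "lower_covers y' = {y}"
    using exists_single_covering_extension y(2,3) by blast
  then have "y' \<in> level (Suc (Suc n))"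
    using upper_covers_level[OF y(1)] upper_covers_iff lower_covers_iff by blast
  moreover have "card (upper_covers y) \<le> Suc r"
    using card_upper_covers[of y] y(1,2) by (simp add: rank_level_def)
  moreover have "(down ^^ Suc (Suc n)) (point y') = point bot"
    unfolding funpow_Suc_right[of "Suc n"] using y(4) down_point[OF y'] by simp
  moreover have "(up ^^ Suc (Suc n)) (point bot) y' = 1"
    unfolding funpow.simps(2)[of "Suc n"] using y(5) y' by (simp add: up_def[of _ y'])
  ultimately show ?case using y' by blast
qed

section \<open>Strict rank growth\<close>

text \<open>
  The operator \<open>D\<close> kills the point mass at the minimum, and each \<open>U\<close> that it is moved past
  contributes one summand \<open>r\<close>.
\<close>

lemma up_down_chain_count:
  "up (down ((up ^^ n) (point bot))) = (\<lambda>x. int (r * n) * (up ^^ n) (point bot) x)"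
proof (induction n)
  case 0
  have "supported_on (level 0) (point bot)" by (simp add: supported_on_def point_def level_0)
  from down_level_0[OF this] show ?case by (simp add: up_def)
next
  case (Suc n)
  let ?g = "(up ^^ n) (point bot)"
  have "supported_on P ?g"
    using bot_in supported_on_P_up by (cases n) (auto simp: supported_on_def point_def)
  then have "down (up ?g) = (\<lambda>x. int (r * Suc n) * ?g x + 0 * ?g x)"
    using down_up Suc by (simp add: algebra_simps)
  then have "up (down (up ?g)) = (\<lambda>x. int (r * Suc n) * up ?g x + 0 * up ?g x)"
    by (simp only: up_linear)
  then show ?case by simp
qed

theorem strict_rank_growth:
  assumes "n \<ge> 1"
  shows "card (level n) < card (level (Suc n))"
proof (rule ccontr)
  assume "\<not> ?thesis"
  then have card: "card (level (Suc n)) \<le> card (level n)" by simp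
  let ?c = "int (r * Suc n)"
  obtain y where y: "y \<in> level (Suc n)" "(down ^^ Suc n) (point y) = point bot"
    "(up ^^ Suc n) (point bot) y = 1"
    using exists_single_chain_element by blast
  let ?w = "(up ^^ Suc n) (point bot)"
  have "supported_on (level (Suc n)) (point y)"
    using y(1) by (simp add: supported_on_def point_def)
  then obtain q where q: "supported_on (level (Suc n)) q" "up (down q) = ?w"
    using up_down_divides_funpow[of "Suc n" "point y" n] y(2) by auto
  have w: "supported_on (level (Suc n)) ?w"
    using q supported_on_up supported_on_down by metis
  let ?h = "\<lambda>x. ?c * q x + (- 1) * ?w x"
  have h: "supported_on (level (Suc n)) ?h"
    using q(1) w by (rule supported_on_linear)
  have "up (down ?h) = (\<lambda>x. 0)"
    unfolding up_down_linear q(2) up_down_chain_count by simp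
  then have "down ?h = (\<lambda>x. 0)"
    using up_injective supported_on_down[OF h] by blast
  then have "?h = (\<lambda>x. 0)"
    using down_injective_if_no_growth[OF card h] by blast
  then have "?h y = 0" by (rule fun_cong)
  then have "1 = ?c * q y" unfolding y(3) by linarith
  then have "?c dvd 1" by (rule dvdI)
  then have "r * Suc n = 1" by (simp only: zdvd1_eq abs_of_nat of_nat_eq_1_iff)
  then show False using assms by (simp only: nat_mult_eq_1_iff) simp
qed

end

theorem corollary2p7:
  fixes r :: nat
    and P :: "'a set"
    and le :: "('a \<times> 'a) set"
    and bot :: 'a
    and rk :: "'a \<Rightarrow> nat"
  assumes "differential_poset r P le bot rk"
  shows "\<forall>n\<ge>1. card (rank_level P rk n) < card (rank_level P rk (n + 1))"
  using differential_poset.strict_rank_growth[OF assms] by simp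

end
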